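(* Let $\mathfrak g$ be a (nonzero) nilpotent Lie algebra endowed with a strongly non-nilpotent complex structure. Then $\mathfrak g$ is at least $3$-step nilpotent, i.e. its nilpotency step $s$ satisfies $s\geq 3$.
   Context: Lie algebras are real and finite-dimensional. The ascending central series of $\mathfrak g$ is $\mathfrak g_0=\{0\}$, $\mathfrak g_k=\{X\in\mathfrak g \mid [X,\mathfrak g]\subseteq \mathfrak g_{k-1}\}$ for $k\geq 1$; the nilpotency step of a nilpotent $\mathfrak g$ is the smallest integer $s\geq1$ with $\mathfrak g_s=\mathfrak g$. A complex structure on $\mathfrak g$ is a linear endomorphism $J$ with $J^2=-\mathrm{Id}$ and $[X,Y]+J[JX,Y]+J[X,JY]-[JX,JY]=0$ for all $X,Y\in\mathfrak g$. Let $\mathfrak a_1(J)=\{X\in\mathfrak g \mid [X,\mathfrak g]=0 \text{ and } [JX,\mathfrak g]=0\}$. $J$ is strongly non-nilpotent (SnN) if $\mathfrak a_1(J)=\{0\}$. *)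

theory Defs
  imports "HOL-Analysis.Analysis"
begin

text \<open>
  The underlying vector space of the Lie algebra is the whole type. The zero space is included.
\<close>

locale real_lie_algebra =
  fixes bracket :: "'a::real_vector \<Rightarrow> 'a \<Rightarrow> 'a"
  assumes finite_dimensional: "\<exists>B :: 'a set. finite B \<and> span B = UNIV"
    and bilinear_bracket: "bilinear bracket"
    and alternating: "bracket x x = 0"
    and jacobi: "bracket x (bracket y z) + bracket y (bracket z x) + bracket z (bracket x y) = 0"

primrec ascending_central :: "('a::real_vector \<Rightarrow> 'a \<Rightarrow> 'a) \<Rightarrow> nat \<Rightarrow> 'a set" where
  "ascending_central bracket 0 = {0}"
| "ascending_central bracket (Suc k) = {x. \<forall>y. bracket x y \<in> ascending_central bracket k}"

definition nilpotent_lie :: "('a::real_vector \<Rightarrow> 'a \<Rightarrow> 'a) \<Rightarrow> bool" where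
  "nilpotent_lie bracket \<longleftrightarrow> (\<exists>k. ascending_central bracket k = UNIV)"

text \<open>
  Meaningful only for nilpotent Lie algebras. The constraint \<open>s \<ge> 1\<close> makes the zero algebra
  1-step nilpotent, like every other abelian Lie algebra.
\<close>

definition nilpotency_step :: "('a::real_vector \<Rightarrow> 'a \<Rightarrow> 'a) \<Rightarrow> nat" where
  "nilpotency_step bracket = (LEAST s. s \<ge> 1 \<and> ascending_central bracket s = UNIV)"

definition complex_structure ::
    "('a::real_vector \<Rightarrow> 'a \<Rightarrow> 'a) \<Rightarrow> ('a \<Rightarrow> 'a) \<Rightarrow> bool" where
  "complex_structure bracket J \<longleftrightarrow>
     linear J \<and> (\<forall>x. J (J x) = - x) \<and>
     (\<forall>x y. bracket x y + J (bracket (J x) y) + J (bracket x (J y)) - bracket (J x) (J y) = 0)"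

definition a1_ideal :: "('a::real_vector \<Rightarrow> 'a \<Rightarrow> 'a) \<Rightarrow> ('a \<Rightarrow> 'a) \<Rightarrow> 'a set" where
  "a1_ideal bracket J = {x. (\<forall>y. bracket x y = 0) \<and> (\<forall>y. bracket (J x) y = 0)}"

definition strongly_non_nilpotent ::
    "('a::real_vector \<Rightarrow> 'a \<Rightarrow> 'a) \<Rightarrow> ('a \<Rightarrow> 'a) \<Rightarrow> bool" where
  "strongly_non_nilpotent bracket J \<longleftrightarrow> a1_ideal bracket J = {0}"

end

theory Submission
  imports Defs
begin

text \<open>
  If the step is at most \<open>2\<close>, then every bracket is central. Evaluating the integrability
  condition at a central \<open>x\<close> leaves \<open>J [J x, y] = [J x, J y]\<close>, so the central element
  \<open>[J x, y]\<close> has a central image under \<open>J\<close>; it lies in \<open>\<aa>\<^sub>1(J) = {0}\<close>, and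
  hence vanishes. Thus \<open>J x\<close> is central as well, which puts \<open>x\<close> itself in
  \<open>\<aa>\<^sub>1(J) = {0}\<close>. The centre is therefore trivial, and an algebra with trivial centre
  has an ascending central series that never leaves \<open>{0}\<close> and so cannot exhaust a
  nonzero algebra. The argument is carried by
  \<open>central_eq_zero_if_brackets_central\<close> and \<open>ascending_central_eq_zero_if_trivial_centre\<close>.
\<close>

lemma ascending_central_mono:
  assumes "bilinear bracket" and "m \<le> n"
  shows "ascending_central bracket m \<subseteq> ascending_central bracket n"
proof -
  have "ascending_central bracket k \<subseteq> ascending_central bracket (Suc k)" for k
    using bilinear_lzero[OF assms(1)] by (induction k) auto
  then show ?thesis
    using assms(2) by (rule lift_Suc_mono_le)
qed

lemma ascending_central_eq_zero_if_trivial_centre: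
  assumes "ascending_central bracket 1 = {0}"
  shows "ascending_central bracket k = {0}"
  using assms by (induction k) auto

lemma nilpotency_step_spec:
  assumes "bilinear bracket" and "nilpotent_lie bracket"
  shows "ascending_central bracket (nilpotency_step bracket) = UNIV"
proof -
  obtain k where "ascending_central bracket k = UNIV"
    using assms(2) unfolding nilpotent_lie_def by blast
  \<comment> \<open>Passing from \<open>k\<close> to \<open>Suc k\<close> meets the side condition \<open>s \<ge> 1\<close>
    also for the zero algebra, where \<open>k\<close> may be \<open>0\<close>.\<close>
  then have "Suc k \<ge> 1 \<and> ascending_central bracket (Suc k) = UNIV"
    by simp
  then show ?thesis
    unfolding nilpotency_step_def by (rule LeastI2) simp
qed

text \<open>
  Since \<open>[x, \<cdot>] = 0\<close> kills two of the four terms of the integrability condition, the image of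
  \<open>[J x, \<cdot>]\<close> is \<open>J\<close>-invariant. Being central, this image is contained in
  \<open>\<aa>\<^sub>1(J)\<close>.
\<close>

lemma central_eq_zero_if_brackets_central:
  assumes "complex_structure bracket J"
    and "strongly_non_nilpotent bracket J"
    and x_central: "\<And>y. bracket x y = 0"
    and Jx_brackets_central: "\<And>y z. bracket (bracket (J x) y) z = 0"
  shows "x = 0"
proof -
  have a1_trivial: "u = 0" if "\<And>y. bracket u y = 0" "\<And>y. bracket (J u) y = 0" for u
    using that assms(2) unfolding strongly_non_nilpotent_def a1_ideal_def by blast
  have "J 0 = 0"
    using assms(1) unfolding complex_structure_def by (simp add: linear_0)
  have J_bracket: "J (bracket (J x) y) = bracket (J x) (J y)" for y
  proof -
    have "bracket x y + J (bracket (J x) y) + J (bracket x (J y)) - bracket (J x) (J y) = 0"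
      using assms(1) unfolding complex_structure_def by blast
    then show ?thesis
      by (simp add: x_central \<open>J 0 = 0\<close>)
  qed
  have "bracket (J x) y = 0" for y
    by (rule a1_trivial) (simp_all add: J_bracket Jx_brackets_central)
  then show ?thesis
    by (rule a1_trivial[OF x_central])
qed

theorem corollary3p6:
  fixes bracket :: "'a::real_vector \<Rightarrow> 'a \<Rightarrow> 'a"
    and J :: "'a \<Rightarrow> 'a"
  assumes "real_lie_algebra bracket"
    and "(UNIV :: 'a set) \<noteq> {0}"
    and "nilpotent_lie bracket"
    and "complex_structure bracket J"
    and "strongly_non_nilpotent bracket J"
  shows "nilpotency_step bracket \<ge> 3"
proof (rule ccontr)
  assume "\<not> nilpotency_step bracket \<ge> 3"
  then have step_le: "nilpotency_step bracket \<le> 2"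
    by simp
  have bilinear: "bilinear bracket"
    using assms(1) by (rule real_lie_algebra.bilinear_bracket)
  have second: "ascending_central bracket 2 = UNIV"
    using ascending_central_mono[OF bilinear step_le] nilpotency_step_spec[OF bilinear assms(3)]
    by auto
  then have brackets_central: "bracket (bracket u y) z = 0" for u y z
    by (auto simp: numeral_2_eq_2)
  have "x = 0" if "\<And>y. bracket x y = 0" for x
    using assms(4,5) that brackets_central by (rule central_eq_zero_if_brackets_central)
  moreover have "bracket 0 y = 0" for y
    using bilinear by (rule bilinear_lzero)
  ultimately have "{x. \<forall>y. bracket x y = 0} = {0}"
    by blast
  then have "ascending_central bracket 1 = {0}"
    by simp
  then have "ascending_central bracket 2 = {0}"
    by (rule ascending_central_eq_zero_if_trivial_centre)
  with second assms(2) show False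
    by simp
qed

end
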